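(* In online matching with online items and non-myopic offline agents with private graph edges, there exists a deterministic truthful mechanism that achieves a $\nu=\min(m,n)$ approximation of the offline optimum, where $n$ is the number of buyers and $m$ the number of items. This is tight in the class of deterministic truthful mechanisms when graph edges are private: every deterministic truthful mechanism has competitive ratio at least $\nu$.
   Context: Model. There is a bipartite graph $G=(B,I;E)$ with a set $B$ of $n$ buyers, known in advance, and a set $I$ of $m$ items arriving one by one in an unknown, possibly adversarial order (item $j$ arrives at time $j$). Buyer $i$ is interested in the items $j$ with $(i,j)\in E$, and has a value $v_i\ge 0$ for obtaining at least one item she is interested in (value $0$ otherwise). Private graph edges: both $v_i$ and the set of items $i$ is interested in are private information of $i$. When item $j$ arrives, every buyer declares whether she is interested in $j$ and, if so, a value; she may misreport both. All nonzero bids of buyer $i$ must equal a single value $b_i$ (a bid of $0$ meaning not interested). A deterministic mechanism decides upon the arrival of $j$, immediately and irrevocably and using only the bids on items up to $j$, either to assign $j$ to a buyer who declared interest in it and has not been assigned an item yet, or to leave $j$ unassigned forever. The result is a matching $\mu$ ($\mu^{-1}_i$ is the item received by $i$, $\emptyset$ if none). The mechanism also charges non-negative payments $p_i$, which may be computed as late as the end of the process (tardy) or upon assignment of the buyer (prompt). Welfare. $\mathrm{SW}(\mu)=\sum_{i\in B} v_i\cdot \mathbb{I}[(i,\mu^{-1}_i)\in E]$, and the offline optimum is $\mathrm{OPT}=\mathrm{SW}(\mu^\star)$ where $\mu^\star$ is a maximum weight matching in $G$. A mechanism gives an $\alpha$ approximation ($\alpha\ge 1$) on instances with $n$ buyers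 and $m$ items if $\mathrm{OPT}\le\alpha\cdot \mathrm{SW}(\mu)$ on all such instances (with truthful reports); its competitive ratio is the infimum of such $\alpha$ ($+\infty$ if none exists). Truthfulness. Non-myopic buyers know the whole sequence of items and maximize the quasi-linear utility $u_i=v_i\cdot\mathbb{I}[(i,\mu_i^{-1})\in E]-p_i$. A deterministic mechanism is truthful if, for every instance and every behavior of the other buyers, each agent maximizes her utility by reporting her value and her interests truthfully. Mechanisms are required to be individually rational: truthful agents have non-negative utility. *)

theory Defs
  imports Complex_Main "HOL-Library.Extended_Real"
begin

text \<open>Buyers are the numbers below \<open>n\<close>. Items are the numbers below \<open>m\<close>, numbered by their
  arrival time. Quantifying over all edge sets therefore covers all arrival orders.\<close>

type_synonym edges = "(nat \<times> nat) set"

definition market :: "nat \<Rightarrow> nat \<Rightarrow> edges \<Rightarrow> (nat \<Rightarrow> real) \<Rightarrow> bool" where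
  "market n m E v \<longleftrightarrow> E \<subseteq> {..<n} \<times> {..<m} \<and> (\<forall>i<n. 0 \<le> v i)"

definition matching :: "nat \<Rightarrow> nat \<Rightarrow> edges \<Rightarrow> bool" where
  "matching n m \<mu> \<longleftrightarrow> \<mu> \<subseteq> {..<n} \<times> {..<m} \<and> (\<forall>(i, j)\<in>\<mu>. \<forall>(i', j')\<in>\<mu>. i = i' \<longleftrightarrow> j = j')"

text \<open>The matching \<open>\<mu>\<close> produced by a mechanism may contain pairs outside \<open>E\<close> (when buyers
  misreport); these contribute no value.\<close>

definition obtained_value :: "edges \<Rightarrow> (nat \<Rightarrow> real) \<Rightarrow> edges \<Rightarrow> nat \<Rightarrow> real" where
  "obtained_value E v \<mu> i = v i * of_bool (\<exists>j. (i, j) \<in> \<mu> \<and> (i, j) \<in> E)"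

definition SW :: "nat \<Rightarrow> edges \<Rightarrow> (nat \<Rightarrow> real) \<Rightarrow> edges \<Rightarrow> real" where
  "SW n E v \<mu> = (\<Sum>i<n. obtained_value E v \<mu> i)"

definition OPT :: "nat \<Rightarrow> nat \<Rightarrow> edges \<Rightarrow> (nat \<Rightarrow> real) \<Rightarrow> real" where
  "OPT n m E v = Max (SW n E v ` {\<mu>. matching n m \<mu> \<and> \<mu> \<subseteq> E})"

text \<open>\<open>b i j\<close> is the bid of buyer \<open>i\<close> on item \<open>j\<close>; a bid of \<open>0\<close> declares no interest.
  Bids are padded with \<open>0\<close> outside the actual buyers and items, so that the bid matrix carries
  no information beyond the actual bids.\<close>

type_synonym bids = "nat \<Rightarrow> nat \<Rightarrow> real"

definition report :: "nat \<Rightarrow> (nat \<Rightarrow> real) \<Rightarrow> bool" where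
  "report m r \<longleftrightarrow> (\<exists>c\<ge>0. \<exists>S\<subseteq>{..<m}. r = (\<lambda>j. if j \<in> S then c else 0))"

definition bid_profile :: "nat \<Rightarrow> nat \<Rightarrow> bids \<Rightarrow> bool" where
  "bid_profile n m b \<longleftrightarrow> (\<forall>i<n. report m (b i)) \<and> (\<forall>i\<ge>n. b i = (\<lambda>_. 0))"

definition truthful_bids :: "edges \<Rightarrow> (nat \<Rightarrow> real) \<Rightarrow> bids" where
  "truthful_bids E v i j = (if (i, j) \<in> E then v i else 0)"

record mechanism =
  assign :: "bids \<Rightarrow> nat \<Rightarrow> nat option"  \<comment> \<open>the buyer, if any, that receives a given item\<close>
  payment :: "bids \<Rightarrow> nat \<Rightarrow> real"  \<comment> \<open>may depend on all bids, i.e. payments may be tardy\<close>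

definition outcome :: "nat \<Rightarrow> mechanism \<Rightarrow> bids \<Rightarrow> edges" where
  "outcome m M b = {(i, j). j < m \<and> assign M b j = Some i}"

definition online_mechanism :: "nat \<Rightarrow> nat \<Rightarrow> mechanism \<Rightarrow> bool" where
  "online_mechanism n m M \<longleftrightarrow>
     (\<forall>b b'. \<forall>j<m. bid_profile n m b \<and> bid_profile n m b' \<and> (\<forall>i<n. \<forall>k\<le>j. b i k = b' i k)
        \<longrightarrow> assign M b j = assign M b' j) \<and>
     (\<forall>b. bid_profile n m b \<longrightarrow>
        (\<forall>j<m. \<forall>i. assign M b j = Some i \<longrightarrow>
           i < n \<and> b i j \<noteq> 0 \<and> (\<forall>k<j. assign M b k \<noteq> Some i)) \<and>
        (\<forall>i<n. 0 \<le> payment M b i))"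

definition utility :: "nat \<Rightarrow> mechanism \<Rightarrow> edges \<Rightarrow> (nat \<Rightarrow> real) \<Rightarrow> bids \<Rightarrow> nat \<Rightarrow> real" where
  "utility m M E v b i = obtained_value E v (outcome m M b) i - payment M b i"

text \<open>In the next two definitions, \<open>b\<close> ranges over all profiles: its rows other than \<open>i\<close> are the
  arbitrary reports of the other buyers, and its row \<open>i\<close> is an arbitrary misreport of \<open>i\<close>.\<close>

definition truthful :: "nat \<Rightarrow> nat \<Rightarrow> mechanism \<Rightarrow> bool" where
  "truthful n m M \<longleftrightarrow>
     (\<forall>E v b. \<forall>i<n. market n m E v \<and> bid_profile n m b \<longrightarrow>
        utility m M E v b i \<le> utility m M E v (b(i := truthful_bids E v i)) i)"

definition individually_rational :: "nat \<Rightarrow> nat \<Rightarrow> mechanism \<Rightarrow> bool" where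
  "individually_rational n m M \<longleftrightarrow>
     (\<forall>E v b. \<forall>i<n. market n m E v \<and> bid_profile n m b \<longrightarrow>
        0 \<le> utility m M E v (b(i := truthful_bids E v i)) i)"

definition truthful_mechanism :: "nat \<Rightarrow> nat \<Rightarrow> mechanism \<Rightarrow> bool" where
  "truthful_mechanism n m M \<longleftrightarrow>
     online_mechanism n m M \<and> truthful n m M \<and> individually_rational n m M"

definition approximates :: "nat \<Rightarrow> nat \<Rightarrow> mechanism \<Rightarrow> real \<Rightarrow> bool" where
  "approximates n m M \<alpha> \<longleftrightarrow> 1 \<le> \<alpha> \<and>
     (\<forall>E v. market n m E v \<longrightarrow> OPT n m E v \<le> \<alpha> * SW n E v (outcome m M (truthful_bids E v)))"

text \<open>The infimum of the empty set is \<open>\<infinity>\<close> in \<^typ>\<open>ereal\<close>.\<close>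

definition competitive_ratio :: "nat \<Rightarrow> nat \<Rightarrow> mechanism \<Rightarrow> ereal" where
  "competitive_ratio n m M = Inf (ereal ` {\<alpha>. approximates n m M \<alpha>})"

end

theory Submission
  imports Defs "HOL-Library.FuncSet"
begin

text \<open>
  Upper bound: an item goes to the highest bidder seen so far, provided that the item is the
  first one she bids on; she pays the highest competing bid seen so far. This price only grows
  over time, so nobody gains by hiding interest in early items, and the overall highest bidder is
  always served.

  Lower bound: let all buyers be interested in all items, with values in \<open>[1, 1 + \<epsilon>]\<close>.
  A bounded ratio forces a very high bid to win the first item. Truthfulness then ties the price
  for a set of items to the price for the first item alone, so that a buyer who would still lose
  the first item after a slight increase of her bid cannot win any later item either. A
  pigeonhole argument on a grid of values yields an instance in which this holds for every buyer
  except the one who gets the first item. There the welfare is at most \<open>1 + \<epsilon>\<close>,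
  while the optimum is at least \<open>min m n\<close>.
\<close>

section \<open>Bids, welfare and the offline optimum\<close>

lemma bid_profile_nonneg: "bid_profile n m b \<Longrightarrow> 0 \<le> b i j"
  unfolding bid_profile_def report_def by (cases "i < n") (fastforce, simp)

lemma bid_profile_outside:
  assumes "bid_profile n m b" "b i j \<noteq> 0"
  shows "i < n" "j < m"
proof -
  show "i < n" using assms unfolding bid_profile_def by (metis not_le)
  with assms(1) obtain c S where "S \<subseteq> {..<m}" "b i = (\<lambda>j. if j \<in> S then c else 0)"
    unfolding bid_profile_def report_def by blast
  with assms(2) show "j < m" by (auto split: if_splits)
qed

lemma bid_profile_upd:
  assumes "bid_profile n m b" "i < n" "S \<subseteq> {..<m}" "0 \<le> c"
  shows "bid_profile n m (b(i := (\<lambda>j. if j \<in> S then c else 0)))"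
  using assms unfolding bid_profile_def report_def by auto

lemma bid_profile_truthful_bids:
  assumes "market n m E v"
  shows "bid_profile n m (truthful_bids E v)"
proof -
  have "report m (truthful_bids E v i)" if "i < n" for i
    unfolding report_def
    by (rule exI[of _ "v i"], intro conjI exI[of _ "{j. (i, j) \<in> E}"])
      (use assms that in \<open>auto simp: market_def truthful_bids_def fun_eq_iff\<close>)
  then show ?thesis
    using assms by (auto simp: bid_profile_def market_def truthful_bids_def fun_eq_iff)
qed

lemma obtained_value_nonneg: "market n m E v \<Longrightarrow> i < n \<Longrightarrow> 0 \<le> obtained_value E v \<mu> i"
  by (simp add: obtained_value_def market_def)

lemma finite_matchings: "finite {\<mu>. matching n m \<mu> \<and> \<mu> \<subseteq> E}"
  by (rule finite_subset[of _ "Pow ({..<n} \<times> {..<m})"]) (auto simp: matching_def)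

lemma SW_le_OPT: "matching n m \<mu> \<Longrightarrow> \<mu> \<subseteq> E \<Longrightarrow> SW n E v \<mu> \<le> OPT n m E v"
  unfolding OPT_def by (rule Max_ge) (auto intro: finite_matchings)

lemma OPT_le:
  assumes "\<And>\<mu>. matching n m \<mu> \<Longrightarrow> \<mu> \<subseteq> E \<Longrightarrow> SW n E v \<mu> \<le> c"
  shows "OPT n m E v \<le> c"
proof -
  \<comment> \<open>The empty matching makes the set under \<open>Max\<close> nonempty, as
    \<open>Max_le_iff\<close> requires.\<close>
  have "{} \<in> {\<mu>. matching n m \<mu> \<and> \<mu> \<subseteq> E}" by (simp add: matching_def)
  then show ?thesis
    unfolding OPT_def using assms by (subst Max_le_iff) (auto intro: finite_matchings)
qed

lemma card_fst_matching_le: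
  assumes "matching n m \<mu>"
  shows "card (fst ` \<mu>) \<le> min m n"
proof -
  have sub: "\<mu> \<subseteq> {..<n} \<times> {..<m}" using assms by (simp add: matching_def)
  then have fin: "finite \<mu>" by (rule finite_subset) simp
  have "inj_on snd \<mu>"
    using assms unfolding matching_def inj_on_def by fastforce
  then have "card \<mu> = card (snd ` \<mu>)" by (simp add: card_image)
  also have "\<dots> \<le> card {..<m}" by (rule card_mono) (use sub in auto)
  finally have "card \<mu> \<le> m" by simp
  moreover have "card (fst ` \<mu>) \<le> card \<mu>" by (rule card_image_le[OF fin])
  moreover have "card (fst ` \<mu>) \<le> card {..<n}" by (rule card_mono) (use sub in auto)
  ultimately show ?thesis by simp
qed

text \<open>Only matched buyers contribute, and a matching has at most \<open>min m n\<close> of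
  them. The bound \<open>c\<close> will be instantiated with the welfare of the mechanism.\<close>

lemma OPT_le_min_times:
  assumes mk: "market n m E v" and le: "\<And>i j. (i, j) \<in> E \<Longrightarrow> v i \<le> c" and "0 \<le> c"
  shows "OPT n m E v \<le> real (min m n) * c"
proof (rule OPT_le)
  fix \<mu> assume \<mu>: "matching n m \<mu>" "\<mu> \<subseteq> E"
  have sub: "fst ` \<mu> \<subseteq> {..<n}" using \<mu> by (auto simp: matching_def)
  have "obtained_value E v \<mu> i = 0" if "i \<notin> fst ` \<mu>" for i
    using that by (force simp: obtained_value_def)
  then have "SW n E v \<mu> = (\<Sum>i\<in>fst ` \<mu>. obtained_value E v \<mu> i)"
    unfolding SW_def by (intro sum.mono_neutral_right) (use sub in auto)
  also have "\<dots> \<le> (\<Sum>i\<in>fst ` \<mu>. c)"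
    by (rule sum_mono) (use \<mu> le \<open>0 \<le> c\<close> in \<open>auto simp: obtained_value_def\<close>)
  also have "\<dots> \<le> real (min m n) * c"
    using card_fst_matching_le[OF \<mu>(1)] \<open>0 \<le> c\<close> by (simp add: mult_right_mono del: of_nat_min)
  finally show "SW n E v \<mu> \<le> real (min m n) * c" .
qed

section \<open>The running-maximum mechanism\<close>

text \<open>Rivals' bids on all items up to \<open>j\<close> count, including those of buyers served
  earlier. Ties go to the smaller index, which makes the winner of an item unique.\<close>

definition wins :: "nat \<Rightarrow> bids \<Rightarrow> nat \<Rightarrow> nat \<Rightarrow> bool" where
  "wins n b i j \<longleftrightarrow> i < n \<and> 0 < b i j \<and> (\<forall>k<j. b i k = 0) \<and>
     (\<forall>i'<n. i' \<noteq> i \<longrightarrow> (\<forall>k\<le>j. b i' k < b i j \<or> b i' k = b i j \<and> i < i'))"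

text \<open>The value 0 is inserted so that the maximum also exists for a single buyer. Only bids up
  to item \<open>j\<close> enter, so a winner's price is known when she is served.\<close>

definition price :: "nat \<Rightarrow> bids \<Rightarrow> nat \<Rightarrow> nat \<Rightarrow> real" where
  "price n b i j = Max (insert 0 ((\<lambda>(i', k). b i' k) ` (({..<n} - {i}) \<times> {..j})))"

definition running_max :: "nat \<Rightarrow> mechanism" where
  "running_max n =
     \<lparr>assign = (\<lambda>b j. if \<exists>i. wins n b i j then Some (THE i. wins n b i j) else None),
      payment = (\<lambda>b i. if \<exists>j. wins n b i j then price n b i (THE j. wins n b i j) else 0)\<rparr>"

section \<open>Uniqueness of winners, and properties of the price\<close>

lemma wins_unique: "wins n b i j \<Longrightarrow> wins n b i' j \<Longrightarrow> i = i'"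
  unfolding wins_def by (metis less_asym order_refl)

lemma wins_unique_item: "wins n b i j \<Longrightarrow> wins n b i j' \<Longrightarrow> j = j'"
  unfolding wins_def by (metis less_irrefl linorder_neqE_nat)

lemma assign_running_max: "assign (running_max n) b j = Some i \<longleftrightarrow> wins n b i j"
proof (cases "\<exists>i. wins n b i j")
  case True
  then obtain a where a: "wins n b a j" by blast
  then have "(THE i. wins n b i j) = a" using wins_unique by (intro the_equality)
  then show ?thesis using a wins_unique[OF a, of i] by (auto simp: running_max_def)
qed (auto simp: running_max_def)

lemma payment_running_max:
  assumes "wins n b i j"
  shows "payment (running_max n) b i = price n b i j"
proof -
  have "(THE j. wins n b i j) = j" using assms wins_unique_item by (intro the_equality)
  then show ?thesis using assms by (auto simp: running_max_def)
qed

lemma payment_running_max_loser: "\<nexists>j. wins n b i j \<Longrightarrow> payment (running_max n) b i = 0"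
  unfolding running_max_def by auto

lemma price_nonneg: "0 \<le> price n b i j"
  unfolding price_def by (rule Max_ge) auto

lemma price_ge: "i' < n \<Longrightarrow> i' \<noteq> i \<Longrightarrow> k \<le> j \<Longrightarrow> b i' k \<le> price n b i j"
  unfolding price_def by (rule Max_ge) (auto intro!: rev_image_eqI[of "(i', k)"])

lemma price_le:
  assumes "0 \<le> c" "\<And>i' k. i' < n \<Longrightarrow> i' \<noteq> i \<Longrightarrow> k \<le> j \<Longrightarrow> b i' k \<le> c"
  shows "price n b i j \<le> c"
  unfolding price_def using assms by (subst Max_le_iff) auto

lemma price_mono: "j \<le> j' \<Longrightarrow> price n b i j \<le> price n b i j'"
  by (rule price_le) (auto intro: price_nonneg price_ge)

text \<open>The own row of \<open>i\<close> is excluded from the maximum. A buyer thus cannot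
  influence the price attached to an item, only which item she wins.\<close>

lemma price_upd: "price n (b(i := r)) i j = price n b i j"
  unfolding price_def by (intro arg_cong[of _ _ Max] arg_cong[of _ _ "insert 0"] image_cong)
    (auto split: if_splits)

lemma payment_running_max_nonneg: "0 \<le> payment (running_max n) b i"
  by (cases "\<exists>j. wins n b i j")
    (auto simp: payment_running_max payment_running_max_loser price_nonneg)

lemma wins_cong:
  assumes "\<And>i k. i < n \<Longrightarrow> k \<le> j \<Longrightarrow> b i k = b' i k"
  shows "wins n b i j \<longleftrightarrow> wins n b' i j"
  unfolding wins_def using assms by (intro conj_cong all_cong imp_cong) auto

lemma online_running_max: "online_mechanism n m (running_max n)"
proof -
  have cong: "assign (running_max n) b j = assign (running_max n) b' j"
    if "\<forall>i<n. \<forall>k\<le>j. b i k = b' i k" for b b' j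
    using wins_cong[of n j b b'] that by (simp add: running_max_def)
  have "i < n \<and> b i j \<noteq> 0 \<and> (\<forall>k<j. assign (running_max n) b k \<noteq> Some i)"
    if "assign (running_max n) b j = Some i" for b i j
    using that unfolding assign_running_max by (auto simp: wins_def)
  then show ?thesis
    unfolding online_mechanism_def using payment_running_max_nonneg cong by blast
qed

section \<open>Truthfulness and individual rationality of the running-maximum mechanism\<close>

lemma obtained_running_max:
  assumes "bid_profile n m b"
  shows "obtained_value E v (outcome m (running_max n) b) i
       = v i * of_bool (\<exists>j. wins n b i j \<and> (i, j) \<in> E)"
proof -
  \<comment> \<open>Bids are padded with 0 beyond the actual items, so winning never leaves the
    range that \<open>outcome\<close> keeps.\<close>
  have "j < m" if "wins n b i j" for j
    using bid_profile_outside(2)[OF assms, of i j] that by (auto simp: wins_def)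
  then have "(\<exists>j. (i, j) \<in> outcome m (running_max n) b \<and> (i, j) \<in> E)
      \<longleftrightarrow> (\<exists>j. wins n b i j \<and> (i, j) \<in> E)"
    unfolding outcome_def assign_running_max by auto
  then show ?thesis by (simp add: obtained_value_def)
qed

text \<open>Whatever row \<open>i\<close> of \<open>b\<close> reports, winning an item of interest
  yields exactly \<open>v i\<close> minus its price, and any other outcome yields at most 0. It
  remains to show that truthful utility dominates all these numbers.\<close>

lemma utility_running_max_le:
  assumes "bid_profile n m b" "0 \<le> u" "\<And>j. (i, j) \<in> E \<Longrightarrow> v i - price n b i j \<le> u"
  shows "utility m (running_max n) E v b i \<le> u"
proof (cases "\<exists>j. wins n b i j \<and> (i, j) \<in> E")
  case True
  then show ?thesis using assms
    by (auto simp: utility_def obtained_running_max payment_running_max)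
next
  case False
  then show ?thesis using assms(1,2) payment_running_max_nonneg[of n b i]
    by (auto simp: utility_def obtained_running_max)
qed

text \<open>Truth-telling lets \<open>i\<close> compete for her first interesting item only, which
  is also the cheapest one since prices grow. She wins only if that price is at most
  \<open>v i\<close>, and loses only if it is at least \<open>v i\<close>. Prices are taken in
  \<open>b\<close> itself, to match the bound for misreports.\<close>

lemma utility_running_max_truthful:
  fixes n m E v b i
  assumes mk: "market n m E v" and b: "bid_profile n m b" and i: "i < n"
  defines "u \<equiv> utility m (running_max n) E v (b(i := truthful_bids E v i)) i"
  shows "0 \<le> u" "(i, j) \<in> E \<Longrightarrow> v i - price n b i j \<le> u"
proof -
  define b' where "b' = b(i := truthful_bids E v i)"
  have v: "0 \<le> v i" using mk i by (simp add: market_def)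
  have b': "bid_profile n m b'"
    using bid_profile_truthful_bids[OF mk] b i by (simp add: bid_profile_def b'_def)
  have "0 \<le> u \<and> ((i, j) \<in> E \<longrightarrow> v i - price n b i j \<le> u)"
  proof (cases "(\<exists>j. (i, j) \<in> E) \<and> 0 < v i")
    \<comment> \<open>All truthful bids of \<open>i\<close> are 0, so she never wins. Either she has
      no edge, or her value is 0 and no price is below it.\<close>
    case False
    then have "\<nexists>j. wins n b' i j" by (auto simp: wins_def b'_def truthful_bids_def)
    then have "u = 0"
      using b' unfolding u_def b'_def[symmetric]
      by (simp add: utility_def obtained_running_max payment_running_max_loser)
    with False v show ?thesis using price_nonneg[of n b i j] by auto
  next
    case True
    \<comment> \<open>The only item that the truthful report can win.\<close>
    define j1 where "j1 = (LEAST j. (i, j) \<in> E)"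
    have j1: "(i, j1) \<in> E" unfolding j1_def using True by (metis LeastI)
    have least: "j1 \<le> j" if "(i, j) \<in> E" for j using that unfolding j1_def by (rule Least_le)
    have "(i, k) \<notin> E" if "k < j1" for k using least[of k] that by linarith
    then have row: "b' i j1 = v i" "\<forall>k<j1. b' i k = 0"
      using j1 by (auto simp: b'_def truthful_bids_def)
    show ?thesis
    proof (cases "wins n b' i j1")
      case w: True
      have "price n b i j1 \<le> v i"
      proof (rule price_le[OF v])
        fix i' k assume *: "i' < n" "i' \<noteq> i" "k \<le> j1"
        have "b' i' k < b' i j1 \<or> b' i' k = b' i j1" using w * unfolding wins_def by blast
        then show "b i' k \<le> v i" using row * by (auto simp: b'_def)
      qed
      moreover have "u = v i - price n b i j1"
      proof -
        have "price n b' i j1 = price n b i j1" by (simp add: b'_def price_upd)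
        moreover have "\<exists>j. wins n b' i j \<and> (i, j) \<in> E" using w j1 by blast
        ultimately show ?thesis
          using payment_running_max[OF w] obtained_running_max[OF b', of E v i]
          unfolding u_def b'_def[symmetric] by (simp add: utility_def)
      qed
      ultimately show ?thesis using price_mono[OF least, of j n b i] by auto
    next
      \<comment> \<open>A rival has bid at least \<open>v i\<close> by time \<open>j1\<close>. Hence
        the price of \<open>j1\<close>, and of every later item, is too high to give a positive
        utility.\<close>
      case nw: False
      have "0 < b' i j1" using row True by simp
      with nw i row(2) have "\<exists>i'<n. i' \<noteq> i \<and> (\<exists>k\<le>j1. \<not> b' i' k < b' i j1)"
        unfolding wins_def by blast
      then obtain i' k where *: "i' < n" "i' \<noteq> i" "k \<le> j1" "\<not> b' i' k < b' i j1" by blast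
      then have "v i \<le> b i' k" using row by (simp add: b'_def)
      with * have ge: "v i \<le> price n b i j1" using price_ge[of i' n i k j1 b] by simp
      \<comment> \<open>Before \<open>j1\<close> her bids are 0, and after \<open>j1\<close> her
        nonzero bid on \<open>j1\<close> disqualifies her.\<close>
      have "\<not> wins n b' i j" for j
      proof
        assume w: "wins n b' i j"
        then have "(i, j) \<in> E" by (auto simp: wins_def b'_def truthful_bids_def split: if_splits)
        then have "j1 \<le> j" by (rule least)
        moreover have "\<not> j1 < j" using w row True by (auto simp: wins_def)
        ultimately show False using w nw by (simp add: le_antisym)
      qed
      then have "u = 0"
        using b' unfolding u_def b'_def[symmetric]
        by (simp add: utility_def obtained_running_max payment_running_max_loser)
      then show ?thesis using ge price_mono[OF least, of j n b i] by auto
    qed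
  qed
  then show "0 \<le> u" "(i, j) \<in> E \<Longrightarrow> v i - price n b i j \<le> u" by auto
qed

lemma truthful_running_max: "truthful_mechanism n m (running_max n)"
  unfolding truthful_mechanism_def truthful_def individually_rational_def
proof (intro conjI allI impI)
  fix E v b i assume i: "i < n" and "market n m E v \<and> bid_profile n m b"
  then have mb: "market n m E v" "bid_profile n m b" by auto
  note u = utility_running_max_truthful[OF mb i]
  show "0 \<le> utility m (running_max n) E v (b(i := truthful_bids E v i)) i" by (rule u(1))
  show "utility m (running_max n) E v b i
      \<le> utility m (running_max n) E v (b(i := truthful_bids E v i)) i"
    by (rule utility_running_max_le[OF mb(2)]) (fact u)+
qed (rule online_running_max)

section \<open>Approximation guarantee of the running-maximum mechanism\<close>

text \<open>Among the buyers with at least one edge, the one of highest value is never outbid, so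
  she wins her first interesting item. Her value alone bounds every value that counts in the
  optimum.\<close>

lemma value_le_SW_running_max:
  assumes mk: "market n m E v" and e: "(i0, j0) \<in> E"
  shows "v i0 \<le> SW n E v (outcome m (running_max n) (truthful_bids E v))"
proof -
  define b where "b = truthful_bids E v"
  have b: "bid_profile n m b" using bid_profile_truthful_bids[OF mk] by (simp add: b_def)
  have sub: "E \<subseteq> {..<n} \<times> {..<m}" using mk by (simp add: market_def)
  then have fin: "finite (fst ` E)" using finite_subset by blast
  define V where "V = Max (v ` fst ` E)"
  have le: "v i \<le> V" if "(i, j) \<in> E" for i j
    unfolding V_def by (rule Max_ge) (use fin that in \<open>auto intro: rev_image_eqI\<close>)
  have "V \<in> v ` fst ` E" unfolding V_def by (rule Max_in) (use fin e in auto)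
  then have ex: "\<exists>i. i \<in> fst ` E \<and> v i = V" by auto
  \<comment> \<open>The smallest index among the maximizers is the one favoured by the tie-breaking
    in \<open>wins\<close>.\<close>
  define a where "a = (LEAST i. i \<in> fst ` E \<and> v i = V)"
  have a: "a \<in> fst ` E" "v a = V" using LeastI_ex[OF ex] by (auto simp: a_def)
  have a_least: "a \<le> i" if "(i, j) \<in> E" "v i = V" for i j
    unfolding a_def by (rule Least_le) (use that in \<open>auto intro: rev_image_eqI\<close>)
  define j where "j = (LEAST j. (a, j) \<in> E)"
  have j: "(a, j) \<in> E" unfolding j_def using a(1) by (metis LeastI_ex imageE prod.collapse)
  have j_least: "j \<le> k" if "(a, k) \<in> E" for k using that unfolding j_def by (rule Least_le)
  have an: "a < n" using j sub by auto
  let ?o = "outcome m (running_max n) b"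
  have "V \<le> obtained_value E v ?o a"
  proof (cases "0 < V")
    case True
    have aj: "b a j = V" using j a by (simp add: b_def truthful_bids_def)
    have "(a, k) \<notin> E" if "k < j" for k using j_least[of k] that by linarith
    then have before: "\<forall>k<j. b a k = 0" by (simp add: b_def truthful_bids_def)
    have "b i k < V \<or> b i k = V \<and> a < i" if "i \<noteq> a" for i k
    proof (cases "(i, k) \<in> E")
      case ik: True
      then have "b i k = v i" by (simp add: b_def truthful_bids_def)
      then show ?thesis using le[OF ik] a_least[OF ik] that by linarith
    next
      case False
      then show ?thesis using True by (simp add: b_def truthful_bids_def)
    qed
    then have "wins n b a j"
      unfolding wins_def aj using an True before by blast
    then have "\<exists>j. wins n b a j \<and> (a, j) \<in> E" using j by blast
    then show ?thesis using a by (simp add: obtained_running_max[OF b])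
  next
    case False
    then show ?thesis using obtained_value_nonneg[OF mk an, of ?o] by linarith
  qed
  also have "\<dots> \<le> SW n E v ?o"
    unfolding SW_def by (rule member_le_sum) (use an obtained_value_nonneg[OF mk] in auto)
  finally show ?thesis using le[OF e] by (simp add: b_def)
qed

lemma approximates_running_max:
  assumes "1 \<le> n" "1 \<le> m"
  shows "approximates n m (running_max n) (real (min m n))"
  unfolding approximates_def
proof (intro conjI allI impI)
  fix E v assume mk: "market n m E v"
  show "OPT n m E v
      \<le> real (min m n) * SW n E v (outcome m (running_max n) (truthful_bids E v))"
    by (rule OPT_le_min_times[OF mk value_le_SW_running_max[OF mk]])
      (auto simp: SW_def intro!: sum_nonneg obtained_value_nonneg[OF mk])
qed (use assms in simp)

section \<open>Losing the first item means losing every item\<close>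

text \<open>Buyer \<open>i\<close> looks only at her own row of the market. Giving every buyer the
  same interests \<open>S\<close> and value \<open>c\<close> therefore realizes any type of
  \<open>i\<close> by a simple market.\<close>

lemma utility_single_value:
  assumes "S \<subseteq> {..<m}" "i < n"
  shows "utility m M ({..<n} \<times> S) (\<lambda>_. c) b i
       = c * of_bool (\<exists>j\<in>S. assign M b j = Some i) - payment M b i"
proof -
  have "(\<exists>j. (i, j) \<in> outcome m M b \<and> (i, j) \<in> {..<n} \<times> S)
      \<longleftrightarrow> (\<exists>j\<in>S. assign M b j = Some i)"
    using assms by (auto simp: outcome_def)
  then show ?thesis by (simp add: utility_def obtained_value_def)
qed

text \<open>The true type of \<open>i\<close> is \<open>(S, c)\<close>, and row \<open>i\<close> of
  \<open>b\<close> serves as an arbitrary misreport. This turns truthfulness into inequalities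
  between payments for any two reports of \<open>i\<close>.\<close>

lemma
  assumes M: "truthful_mechanism n m M" and i: "i < n" and S: "S \<subseteq> {..<m}" and c: "0 \<le> c"
    and b: "bid_profile n m b"
  defines "b' \<equiv> b(i := (\<lambda>j. if j \<in> S then c else 0))"
  shows truthful_reportD: "c * of_bool (\<exists>j\<in>S. assign M b j = Some i) - payment M b i
           \<le> c * of_bool (\<exists>j\<in>S. assign M b' j = Some i) - payment M b' i"
    and rational_reportD: "0 \<le> c * of_bool (\<exists>j\<in>S. assign M b' j = Some i) - payment M b' i"
proof -
  have mk: "market n m ({..<n} \<times> S) (\<lambda>_. c)" using S c by (auto simp: market_def)
  have b': "b' = b(i := truthful_bids ({..<n} \<times> S) (\<lambda>_. c) i)"
    using i by (auto simp: b'_def truthful_bids_def fun_eq_iff)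
  show "c * of_bool (\<exists>j\<in>S. assign M b j = Some i) - payment M b i
      \<le> c * of_bool (\<exists>j\<in>S. assign M b' j = Some i) - payment M b' i"
    using M mk b i unfolding truthful_mechanism_def truthful_def
    by (metis b' utility_single_value[OF S i])
  show "0 \<le> c * of_bool (\<exists>j\<in>S. assign M b' j = Some i) - payment M b' i"
    using M mk b i unfolding truthful_mechanism_def individually_rational_def
    by (metis b' utility_single_value[OF S i])
qed

lemma online_mechanismD:
  assumes "online_mechanism n m M" "bid_profile n m b" "bid_profile n m b'" "j < m"
    and "\<forall>i<n. \<forall>k\<le>j. b i k = b' i k"
  shows "assign M b j = assign M b' j"
  using assms unfolding online_mechanism_def by blast

text \<open>When item 0 is assigned, the mechanism cannot rule out that nobody wants a later item.
  In that case refusing \<open>i\<close> leaves at most the sum of the other bids as welfare, while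
  serving her alone is worth \<open>b i 0\<close>, which violates the ratio \<alpha>.\<close>

lemma high_bid_wins_first_item:
  assumes M: "online_mechanism n m M" and ap: "approximates n m M \<alpha>"
    and b: "bid_profile n m b" and i: "i < n" and m: "0 < m"
    and high: "\<alpha> * (\<Sum>k\<in>{..<n} - {i}. b k 0) < b i 0"
  shows "assign M b 0 = Some i"
proof (rule ccontr)
  assume lose: "assign M b 0 \<noteq> Some i"
  \<comment> \<open>The continuation in which all later items are worthless, with the bids on item 0
    as true values.\<close>
  define E where "E = {..<n} \<times> {0::nat}"
  define v where "v = (\<lambda>k. b k 0)"
  have mk: "market n m E v"
    using m bid_profile_nonneg[OF b] by (auto simp: market_def E_def v_def)
  let ?t = "truthful_bids E v"
  have t: "bid_profile n m ?t" by (rule bid_profile_truthful_bids[OF mk])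
  have "\<forall>k<n. \<forall>l\<le>0. ?t k l = b k l"
    by (simp add: truthful_bids_def E_def v_def)
  then have "assign M ?t 0 = assign M b 0"
    by (rule online_mechanismD[OF M t b m])
  then have "obtained_value E v (outcome m M ?t) i = 0"
    using lose by (auto simp: obtained_value_def outcome_def E_def)
  then have "SW n E v (outcome m M ?t) = (\<Sum>k\<in>{..<n} - {i}. obtained_value E v (outcome m M ?t) k)"
    unfolding SW_def using i by (simp add: sum.remove[of "{..<n}" i])
  also have "\<dots> \<le> (\<Sum>k\<in>{..<n} - {i}. b k 0)"
    by (rule sum_mono) (use bid_profile_nonneg[OF b] in \<open>auto simp: obtained_value_def v_def\<close>)
  finally have "\<alpha> * SW n E v (outcome m M ?t) \<le> \<alpha> * (\<Sum>k\<in>{..<n} - {i}. b k 0)"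
    using ap by (intro mult_left_mono) (auto simp: approximates_def)
  also have "\<dots> < b i 0" by (rule high)
  also have "b i 0 = obtained_value E v {(i, 0)} i"
    using i by (simp add: obtained_value_def E_def v_def)
  also have "\<dots> \<le> SW n E v {(i, 0)}"
    unfolding SW_def by (rule member_le_sum) (use i obtained_value_nonneg[OF mk] in auto)
  also have "\<dots> \<le> OPT n m E v"
    by (rule SW_le_OPT) (use i m in \<open>auto simp: matching_def E_def\<close>)
  finally show False using ap mk by (auto simp: approximates_def not_le dest: leD)
qed

text \<open>Suppose \<open>i\<close> wins something at value \<open>w\<close>. Compare three types:
  all items at \<open>w\<close>, all items at a huge \<open>H\<close>, and item 0 alone at
  \<open>v\<close>. The report \<open>bH\<close> wins item 0, and its payment is at least
  \<open>v\<close> by the third type but at most \<open>w\<close> by the first two, although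
  \<open>w < v\<close>.\<close>

lemma loser_of_first_item_gets_nothing:
  assumes M: "truthful_mechanism n m M" and ap: "approximates n m M \<alpha>"
    and b: "bid_profile n m b" and i: "i < n" and m: "0 < m"
    and row: "b i = (\<lambda>j. if j \<in> {..<m} then w else 0)" and w: "0 \<le> w" "w < v"
    and lose: "assign M (b(i := (\<lambda>j. if j \<in> {0} then v else 0))) 0 \<noteq> Some i"
  shows "\<forall>j<m. assign M b j \<noteq> Some i"
proof (rule ccontr)
  assume "\<not> (\<forall>j<m. assign M b j \<noteq> Some i)"
  then have win: "\<exists>j\<in>{..<m}. assign M b j = Some i" by auto
  \<comment> \<open>The absolute value keeps \<open>H\<close> nonnegative, and adding 1 gives the
    strict excess that forces item 0 to go to \<open>i\<close>.\<close>
  define H where "H = \<bar>\<alpha> * (\<Sum>k\<in>{..<n} - {i}. b k 0)\<bar> + 1"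
  define bH where "bH = b(i := (\<lambda>j. if j \<in> {..<m} then H else 0))"
  have H: "0 \<le> H" by (simp add: H_def)
  have bH: "bid_profile n m bH" unfolding bH_def by (rule bid_profile_upd[OF b i _ H]) simp
  have "(\<Sum>k\<in>{..<n} - {i}. bH k 0) = (\<Sum>k\<in>{..<n} - {i}. b k 0)"
    by (rule sum.cong) (auto simp: bH_def)
  then have winH: "assign M bH 0 = Some i"
    using M m by (intro high_bid_wins_first_item[OF _ ap bH i m])
      (auto simp: truthful_mechanism_def bH_def H_def)
  have winH': "\<exists>j\<in>{..<m}. assign M bH j = Some i" using winH m by auto
  have "bid_profile n m (b(i := (\<lambda>j. if j \<in> {0} then v else 0)))"
    by (rule bid_profile_upd[OF b i]) (use m w in auto)
  then have p0: "0 \<le> payment M (b(i := (\<lambda>j. if j \<in> {0} then v else 0))) i"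
    using M i unfolding truthful_mechanism_def online_mechanism_def by blast
  \<comment> \<open>With true interest in item 0 alone at value \<open>v\<close>, the truth loses,
    so lying with \<open>bH\<close> must not be profitable.\<close>
  have "v - payment M bH i \<le> 0"
    using truthful_reportD[OF M i _ _ bH, of "{0}" v] winH lose p0 m w by (simp add: bH_def)
  \<comment> \<open>With true value \<open>H\<close> for all items, both reports obtain the full
    value, so the truthful one must not cost more.\<close>
  moreover have "payment M bH i \<le> payment M b i"
    using truthful_reportD[OF M i _ H b, of "{..<m}"] win winH' by (auto simp: bH_def)
  \<comment> \<open>Row \<open>i\<close> of \<open>b\<close> is truthful for value \<open>w\<close>
    on all items, so individual rationality caps its payment by \<open>w\<close>.\<close>
  moreover have "b(i := (\<lambda>j. if j \<in> {..<m} then w else 0)) = b"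
    using row by (simp add: fun_upd_idem)
  then have "payment M b i \<le> w"
    using rational_reportD[OF M i _ w(1) b, of "{..<m}"] win by auto
  ultimately show False using w by simp
qed

section \<open>The lower bound\<close>

text \<open>On each grid line in direction \<open>i\<close>, at most one point violates the condition for
  \<open>i\<close>, namely the highest point at which \<open>W\<close> fails.\<close>

lemma grid_point:
  fixes W :: "(nat \<Rightarrow> nat) \<Rightarrow> nat \<Rightarrow> bool"
  assumes "n < K"
  shows "\<exists>x\<in>{..<n} \<rightarrow>\<^sub>E {..<K}. \<forall>i<n. W x i \<or> (\<exists>s. x i < s \<and> s < K \<and> \<not> W (x(i := s)) i)"
proof (rule ccontr)
  assume contra: "\<not> ?thesis"
  let ?G = "{..<n} \<rightarrow>\<^sub>E {..<K}"
  define Bad where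
    "Bad i = {x\<in>?G. \<not> W x i \<and> (\<forall>s. x i < s \<and> s < K \<longrightarrow> W (x(i := s)) i)}" for i
  have fin: "finite ?G" by (rule finite_PiE) auto
  have card_bad: "card (Bad i) \<le> K ^ (n - 1)" if "i < n" for i
  proof -
    let ?r = "\<lambda>x. restrict x ({..<n} - {i})"
    \<comment> \<open>Dropping coordinate \<open>i\<close> loses nothing on bad points: of two on
      the same line, the lower would force \<open>W\<close> to hold at the higher.\<close>
    have inj: "inj_on ?r (Bad i)"
    proof (rule inj_onI)
      fix x y assume x: "x \<in> Bad i" and y: "y \<in> Bad i" and eq: "?r x = ?r y"
      have off: "x k = y k" if "k \<noteq> i" for k
      proof (cases "k < n")
        case True
        then show ?thesis using fun_cong[OF eq, of k] that by simp
      next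
        case False
        then show ?thesis using x y by (auto simp: Bad_def PiE_def extensional_def)
      qed
      then have upd: "x(i := y i) = y" "y(i := x i) = x" by (auto simp: fun_eq_iff)
      have lt: "x i < K" "y i < K" using x y \<open>i < n\<close> by (auto simp: Bad_def PiE_iff)
      have "\<not> x i < y i"
      proof
        assume "x i < y i"
        with x lt have "W (x(i := y i)) i" by (simp add: Bad_def)
        with y upd show False by (simp add: Bad_def)
      qed
      moreover have "\<not> y i < x i"
      proof
        assume "y i < x i"
        with y lt have "W (y(i := x i)) i" by (simp add: Bad_def)
        with x upd show False by (simp add: Bad_def)
      qed
      ultimately have "x i = y i" by simp
      then show "x = y" using off by (intro ext) metis
    qed
    have "card (Bad i) \<le> card (({..<n} - {i}) \<rightarrow>\<^sub>E {..<K})"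
      by (rule card_inj_on_le[OF inj]) (auto simp: Bad_def intro!: finite_PiE split: if_splits dest: PiE_mem)
    also have "\<dots> = K ^ (n - 1)" using \<open>i < n\<close> by (simp add: card_PiE)
    finally show ?thesis .
  qed
  have "?G \<subseteq> (\<Union>i<n. Bad i)"
  proof
    fix x assume x: "x \<in> ?G"
    have "\<not> (\<forall>i<n. W x i \<or> (\<exists>s. x i < s \<and> s < K \<and> \<not> W (x(i := s)) i))"
      by (rule contrapos_nn[OF contra]) (rule bexI[OF _ x])
    then show "x \<in> (\<Union>i<n. Bad i)" using x by (auto simp: Bad_def)
  qed
  then have "card ?G \<le> card (\<Union>i<n. Bad i)"
    by (rule card_mono[rotated]) (auto simp: Bad_def intro: finite_subset[OF _ fin])
  also have "\<dots> \<le> (\<Sum>i<n. card (Bad i))" by (rule card_UN_le) simp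
  also have "\<dots> \<le> (\<Sum>i<n. K ^ (n - 1))" by (rule sum_mono) (use card_bad in auto)
  finally have "K ^ n \<le> n * K ^ (n - 1)" by (simp add: card_PiE)
  \<comment> \<open>Since \<open>n < K\<close>, the bad points of all \<open>n\<close> directions
    together cannot fill the grid.\<close>
  moreover have "n * K ^ (n - 1) < K ^ n"
    using assms mult_strict_right_mono[of n K "K ^ (n - 1)"] by (cases n) auto
  ultimately show False by simp
qed

text \<open>The grid lemma is applied with \<open>W\<close> meaning that \<open>i\<close> gets item
  0. At the point found, every other buyer would still lose item 0 at some higher grid value and
  thus gets nothing at all.\<close>

lemma min_le_approximation:
  assumes M: "truthful_mechanism n m M" and ap: "approximates n m M \<alpha>"
    and n: "1 \<le> n" and m: "1 \<le> m" and "0 < \<epsilon>"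
  shows "real (min m n) \<le> \<alpha> * (1 + \<epsilon>)"
proof -
  define E where "E = {..<n} \<times> {..<m}"
  \<comment> \<open>There are \<open>Suc n\<close> levels, more than the number of directions as the
    pigeonhole needs, all within [1, 1 + \<epsilon>].\<close>
  define val where "val x i = 1 + \<epsilon> * real (x i) / real (Suc n)" for x :: "nat \<Rightarrow> nat" and i :: nat
  define bid where "bid x = truthful_bids E (val x)" for x
  have m0: "0 < m" using m by simp
  have on: "online_mechanism n m M" using M by (simp add: truthful_mechanism_def)
  have val_ge: "1 \<le> val x i" for x i using \<open>0 < \<epsilon>\<close> by (simp add: val_def)
  have mk: "market n m E (val x)" for x
    using order_trans[OF zero_le_one val_ge] by (auto simp: market_def E_def)
  have bp: "bid_profile n m (bid x)" for x
    unfolding bid_def by (rule bid_profile_truthful_bids[OF mk])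
  obtain x where x: "x \<in> {..<n} \<rightarrow>\<^sub>E {..<Suc n}"
    and good: "\<And>i. i < n \<Longrightarrow> assign M (bid x) 0 = Some i \<or>
      (\<exists>s. x i < s \<and> s < Suc n \<and> assign M (bid (x(i := s))) 0 \<noteq> Some i)"
    using grid_point[of n "Suc n" "\<lambda>x i. assign M (bid x) 0 = Some i"] by auto
  have val_le: "val x i \<le> 1 + \<epsilon>" if "i < n" for i
  proof -
    have "x i \<le> Suc n" using PiE_mem[OF x, of i] that by simp
    then have "real (x i) / real (Suc n) \<le> 1" by simp
    then have "\<epsilon> * (real (x i) / real (Suc n)) \<le> \<epsilon> * 1"
      using \<open>0 < \<epsilon>\<close> by (intro mult_left_mono) auto
    then show ?thesis by (simp add: val_def)
  qed
  let ?o = "outcome m M (bid x)"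
  have loser: "obtained_value E (val x) ?o i = 0"
    if i: "i < n" and l: "assign M (bid x) 0 \<noteq> Some i" for i
  proof -
    obtain s where s: "x i < s" "assign M (bid (x(i := s))) 0 \<noteq> Some i"
      using good[OF i] l by auto
    define v where "v = val (x(i := s)) i"
    have less: "val x i < v" using s(1) \<open>0 < \<epsilon>\<close> by (simp add: v_def val_def divide_strict_right_mono)
    then have v0: "0 \<le> v" using val_ge[of x i] by linarith
    \<comment> \<open>This narrowed report has the same bids on item 0 as the raised grid point. By
      the online property item 0 is then assigned in the same way.\<close>
    let ?b = "(bid x)(i := (\<lambda>j. if j \<in> {0} then v else 0))"
    have "bid_profile n m ?b"
      by (rule bid_profile_upd[OF bp i]) (use m0 v0 in auto)
    moreover have "\<forall>k<n. \<forall>j\<le>0. ?b k j = bid (x(i := s)) k j"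
      using m0 by (auto simp: bid_def truthful_bids_def E_def v_def val_def)
    ultimately have "assign M ?b 0 = assign M (bid (x(i := s))) 0"
      by (intro online_mechanismD[OF on _ bp m0])
    with s(2) have lose: "assign M ?b 0 \<noteq> Some i" by simp
    have row: "bid x i = (\<lambda>j. if j \<in> {..<m} then val x i else 0)"
      using i by (auto simp: bid_def truthful_bids_def E_def)
    have "0 \<le> val x i" using val_ge[of x i] by linarith
    then have "\<forall>j<m. assign M (bid x) j \<noteq> Some i"
      by (rule loser_of_first_item_gets_nothing[OF M ap bp i m0 row _ less lose])
    then show ?thesis by (auto simp: obtained_value_def outcome_def)
  qed
  have SW_le: "SW n E (val x) ?o \<le> 1 + \<epsilon>"
  proof (cases "\<exists>a<n. assign M (bid x) 0 = Some a")
    case True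
    then obtain a where a: "a < n" "assign M (bid x) 0 = Some a" by auto
    have "SW n E (val x) ?o = obtained_value E (val x) ?o a"
      unfolding SW_def using a loser by (simp add: sum.remove[of "{..<n}" a])
    also have "\<dots> \<le> val x a" using val_ge[of x a] by (auto simp: obtained_value_def)
    finally show ?thesis using val_le[OF a(1)] by simp
  next
    case False
    then show ?thesis using loser \<open>0 < \<epsilon>\<close> by (simp add: SW_def)
  qed
  \<comment> \<open>All buyers want all items, so the diagonal is available and serves
    \<open>min m n\<close> buyers of value at least 1.\<close>
  let ?\<mu> = "(\<lambda>i. (i, i)) ` {..<min m n}"
  have "real (min m n) = (\<Sum>i<min m n. 1)" by simp
  also have "\<dots> \<le> (\<Sum>i<min m n. obtained_value E (val x) ?\<mu> i)"
    by (rule sum_mono) (use val_ge in \<open>auto simp: obtained_value_def E_def image_iff\<close>)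
  also have "\<dots> \<le> SW n E (val x) ?\<mu>"
    unfolding SW_def by (rule sum_mono2) (use obtained_value_nonneg[OF mk] in auto)
  also have "\<dots> \<le> OPT n m E (val x)"
    by (rule SW_le_OPT) (auto simp: matching_def E_def)
  also have "\<dots> \<le> \<alpha> * SW n E (val x) ?o"
    using ap mk by (simp add: approximates_def bid_def)
  also have "\<dots> \<le> \<alpha> * (1 + \<epsilon>)"
    using SW_le ap by (intro mult_left_mono) (auto simp: approximates_def)
  finally show ?thesis .
qed

lemma min_le_competitive_ratio:
  assumes "truthful_mechanism n m M" "1 \<le> n" "1 \<le> m"
  shows "ereal (real (min m n)) \<le> competitive_ratio n m M"
  unfolding competitive_ratio_def
proof (rule Inf_greatest)
  fix r assume "r \<in> ereal ` {\<alpha>. approximates n m M \<alpha>}"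
  then obtain \<alpha> where r: "r = ereal \<alpha>" and ap: "approximates n m M \<alpha>" by auto
  have pos: "1 \<le> \<alpha>" using ap by (simp add: approximates_def)
  have "real (min m n) \<le> \<alpha>"
  proof (rule field_le_epsilon)
    fix e :: real assume "0 < e"
    \<comment> \<open>The choice \<epsilon> = e / \<alpha> turns the factor 1 + \<epsilon> into an
      additive error e.\<close>
    then have "real (min m n) \<le> \<alpha> * (1 + e / \<alpha>)"
      using pos by (intro min_le_approximation[OF assms(1) ap assms(2,3)]) simp
    then show "real (min m n) \<le> \<alpha> + e" using pos by (simp add: algebra_simps)
  qed
  then show "ereal (real (min m n)) \<le> r" by (simp add: r)
qed

theorem theorem6:
  fixes n :: nat
  assumes "n \<ge> 1"
  shows "(\<exists>M. \<forall>m\<ge>1. truthful_mechanism n m M \<and> approximates n m M (real (min m n))) \<and>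
         (\<forall>m\<ge>1. \<forall>M. truthful_mechanism n m M \<longrightarrow>
            ereal (real (min m n)) \<le> competitive_ratio n m M)"
\<comment> \<open>The witness does not mention \<open>m\<close>, so one mechanism serves every
  number of items.\<close>
proof (intro conjI allI impI exI[of _ "running_max n"])
  fix m :: nat assume "m \<ge> 1"
  then show "approximates n m (running_max n) (real (min m n))"
    using assms by (rule approximates_running_max[rotated])
next
  fix m :: nat and M assume "m \<ge> 1" "truthful_mechanism n m M"
  then show "ereal (real (min m n)) \<le> competitive_ratio n m M"
    using assms by (intro min_le_competitive_ratio)
qed (rule truthful_running_max)

end
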